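(* Let $\theta_1,\theta_2\in\mathbb{R}$ with $\theta_1^2+\theta_2^2<1$ and $\theta_1\neq 0$, and let $$G_\theta^{-1}=\begin{pmatrix}1-\theta_1^2 & -\theta_1\theta_2\\ -\theta_1\theta_2 & 1-\theta_2^2\end{pmatrix}.$$ For a real symmetric positive definite $2\times 2$ matrix $W$ put $$C^{N}_\theta[W]=\mathrm{Tr}\{WG_\theta^{-1}\}+2\sqrt{\det (WG_\theta^{-1})}.$$ Let $M_h$ be the set of real symmetric $2\times 2$ matrices. Then the following three sets are equal: $$D_N=\{V\in M_h : \mathrm{Tr}\{WV\}\ge C^N_\theta[W]\ \text{ for all } W>0\},$$ $$D_{GM}=\{V\in M_h : \mathrm{Tr}\{G_\theta^{-1}V^{-1}\}\le 1,\ V>G_\theta^{-1}\},$$ $$D=\{V\in M_h : \det(V-G_\theta^{-1})\ge\det G_\theta^{-1},\ V>G_\theta^{-1}\}.$$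
   Context: Here $G_\theta$ is the symmetric-logarithmic-derivative (SLD) quantum Fisher information matrix, with respect to $(\theta_1,\theta_2)$, of the qubit model $\rho_\theta=\frac12\begin{pmatrix}1+\theta_2&\theta_1e^{-i\theta_3}\\ \theta_1e^{i\theta_3}&1-\theta_2\end{pmatrix}$ with known phase $\theta_3$, and $C^N_\theta[W]$ is the Nagaoka bound for the weighted trace of the mean square error matrix; only the explicit formulas in the claim are needed. For real symmetric matrices, $A>B$ means that $A-B$ is positive definite, and $W$ ranges over real symmetric positive definite $2\times 2$ matrices. *)

theory Defs
  imports "HOL-Analysis.Analysis"
begin

definition sym_mats :: "(real ^ 2 ^ 2) set" where
  "sym_mats = {A. transpose A = A}"

text \<open>Symmetry is part of the notion: over the reals, positivity of the quadratic form
  alone does not imply it.\<close>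

definition pos_def :: "real ^ 2 ^ 2 \<Rightarrow> bool" where
  "pos_def A \<longleftrightarrow> transpose A = A \<and> (\<forall>x. x \<noteq> 0 \<longrightarrow> x \<bullet> (A *v x) > 0)"

text \<open>The inverse of the SLD quantum Fisher information matrix with respect to the first two
  parameters of the qubit model with Bloch vector
  \<open>(\<theta>1 cos \<theta>3, \<theta>1 sin \<theta>3, \<theta>2)\<close>, \<open>\<theta>3\<close> known; it does not depend on \<open>\<theta>3\<close>.\<close>

definition G_inv :: "real \<Rightarrow> real \<Rightarrow> real ^ 2 ^ 2" where
  "G_inv \<theta>1 \<theta>2 = vector [vector [1 - \<theta>1\<^sup>2, - \<theta>1 * \<theta>2],
                          vector [- \<theta>1 * \<theta>2, 1 - \<theta>2\<^sup>2]]"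

definition nagaoka_bound :: "real \<Rightarrow> real \<Rightarrow> real ^ 2 ^ 2 \<Rightarrow> real" where
  "nagaoka_bound \<theta>1 \<theta>2 W =
     trace (W ** G_inv \<theta>1 \<theta>2) + 2 * sqrt (det (W ** G_inv \<theta>1 \<theta>2))"

definition D_N :: "real \<Rightarrow> real \<Rightarrow> (real ^ 2 ^ 2) set" where
  "D_N \<theta>1 \<theta>2 =
     {V \<in> sym_mats. \<forall>W. pos_def W \<longrightarrow> trace (W ** V) \<ge> nagaoka_bound \<theta>1 \<theta>2 W}"

text \<open>For \<open>\<theta>1\<^sup>2 + \<theta>2\<^sup>2 < 1\<close> the second condition makes \<open>V\<close> invertible, so
  \<open>matrix_inv V\<close> is the genuine inverse for every member of the set.\<close>

definition D_GM :: "real \<Rightarrow> real \<Rightarrow> (real ^ 2 ^ 2) set" where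
  "D_GM \<theta>1 \<theta>2 =
     {V \<in> sym_mats. trace (G_inv \<theta>1 \<theta>2 ** matrix_inv V) \<le> 1 \<and> pos_def (V - G_inv \<theta>1 \<theta>2)}"

definition D_det :: "real \<Rightarrow> real \<Rightarrow> (real ^ 2 ^ 2) set" where
  "D_det \<theta>1 \<theta>2 =
     {V \<in> sym_mats. det (V - G_inv \<theta>1 \<theta>2) \<ge> det (G_inv \<theta>1 \<theta>2) \<and> pos_def (V - G_inv \<theta>1 \<theta>2)}"

end

(* With A = V - G_inv, the three conditions become conditions on A. Membership in D_N says that
   trace (W ** A) >= 2 * sqrt (det W * det G_inv) for all W > 0. By the 2x2 inequality
   trace (W ** A) >= 2 * sqrt (det W * det A) this holds if A > 0 and det A >= det G_inv;
   conversely, W = diag(t, 1/t) with t large forces A$1$1 > 0, and taking W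
   proportional to the adjugate of the matrix that agrees with A except at (2,2) and has
   determinant det G_inv forces det A >= det G_inv.
   For D_GM one uses trace (G ** adj V) = det V + det G - det (V - G). *)

theory Submission
  imports Defs
begin

lemma sym_mat2_iff:
  fixes A :: "real ^ 2 ^ 2"
  shows "transpose A = A \<longleftrightarrow> A$2$1 = A$1$2"
  by (auto simp: transpose_def vec_eq_iff forall_2)

lemma quadratic_form2:
  fixes A :: "real ^ 2 ^ 2"
  assumes "A$2$1 = A$1$2"
  shows "x \<bullet> (A *v x) = A$1$1 * (x$1)\<^sup>2 + 2 * A$1$2 * x$1 * x$2 + A$2$2 * (x$2)\<^sup>2"
  using assms by (simp add: inner_vec_def matrix_vector_mult_def sum_2 power2_eq_square algebra_simps)

lemma trace_mult2:
  fixes A B :: "real ^ 2 ^ 2"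
  shows "trace (A ** B) = A$1$1 * B$1$1 + A$1$2 * B$2$1 + A$2$1 * B$1$2 + A$2$2 * B$2$2"
  by (simp add: trace_def matrix_matrix_mult_def sum_2)

text \<open>Sylvester's criterion in dimension two, which reduces every positivity claim below to
  entries and determinants.\<close>

lemma pos_def2_iff:
  "pos_def A \<longleftrightarrow> A$2$1 = A$1$2 \<and> A$1$1 > 0 \<and> det A > 0"
proof (cases "A$2$1 = A$1$2")
  case False
  then show ?thesis by (simp add: pos_def_def sym_mat2_iff)
next
  case sym: True
  show ?thesis
  proof
    assume pd: "pos_def A"
    have pos: "A$1$1 * (x$1)\<^sup>2 + 2 * A$1$2 * x$1 * x$2 + A$2$2 * (x$2)\<^sup>2 > 0" if "x \<noteq> 0" for x :: "real ^ 2"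
      using pd that quadratic_form2[OF sym, of x] by (auto simp: pos_def_def)
    have "(vector [1, 0] :: real ^ 2) \<noteq> 0"
      by (simp add: vec_eq_iff forall_2)
    from pos[OF this] have a: "A$1$1 > 0" by simp
    \<comment> \<open>At this vector the quadratic form takes the value
      \<open>A$1$1 * det A\<close>.\<close>
    have "(vector [- A$1$2, A$1$1] :: real ^ 2) \<noteq> 0"
      using a by (simp add: vec_eq_iff forall_2)
    from pos[OF this] have "A$1$1 * det A > 0"
      by (simp add: det_2 sym power2_eq_square algebra_simps)
    with a have "det A > 0" by (simp add: zero_less_mult_iff)
    with sym a show "A$2$1 = A$1$2 \<and> A$1$1 > 0 \<and> det A > 0" by simp
  next
    assume *: "A$2$1 = A$1$2 \<and> A$1$1 > 0 \<and> det A > 0"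
    have "x \<bullet> (A *v x) > 0" if x: "x \<noteq> 0" for x
    proof -
      \<comment> \<open>Completing the square.\<close>
      have eq: "A$1$1 * (x \<bullet> (A *v x)) = (A$1$1 * x$1 + A$1$2 * x$2)\<^sup>2 + det A * (x$2)\<^sup>2"
        by (simp add: quadratic_form2[OF sym] det_2 sym power2_eq_square algebra_simps)
      have "\<dots> > 0"
      proof (cases "x$2 = 0")
        case True
        with x have "x$1 \<noteq> 0" by (simp add: vec_eq_iff forall_2)
        with True * show ?thesis by simp
      next
        case False
        with * show ?thesis by (intro add_nonneg_pos) simp_all
      qed
      with eq * show ?thesis by (metis zero_less_mult_pos)
    qed
    with sym show "pos_def A" by (simp add: pos_def_def sym_mat2_iff)
  qed
qed

lemma pos_def_add: "pos_def A \<Longrightarrow> pos_def B \<Longrightarrow> pos_def (A + B)"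
  by (simp add: pos_def_def sym_mat2_iff matrix_vector_mult_add_rdistrib inner_add_right add_pos_pos)

lemma trace_mult_ge_sqrt_det:
  assumes W: "pos_def W" and A: "pos_def A"
  shows "trace (W ** A) \<ge> 2 * sqrt (det W * det A)"
proof -
  define w x z a b c where "w = W$1$1" "x = W$1$2" "z = W$2$2" "a = A$1$1" "b = A$1$2" "c = A$2$2"
  note defs = this
  have sym: "W$2$1 = x" "A$2$1 = b" and w: "w > 0" and a: "a > 0"
    and dW: "det W > 0" and dA: "det A > 0"
    using W A by (simp_all add: pos_def2_iff defs)
  have D: "w * z = det W + x\<^sup>2" and E: "a * c = det A + b\<^sup>2"
    using sym by (simp_all add: det_2 defs power2_eq_square)
  define s where "s = sqrt (det W * det A)"
  have s: "s \<ge> 0" "s\<^sup>2 = det W * det A"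
    using dW dA by (simp_all add: s_def)
  have T: "trace (W ** A) = w * a + 2 * x * b + z * c"
    using sym by (simp add: trace_mult2 defs)
  \<comment> \<open>After scaling by \<open>w * a > 0\<close>, \<open>z\<close> and \<open>c\<close>
    occur only in \<open>w * z\<close> and \<open>a * c\<close>, which \<open>D\<close> and
    \<open>E\<close> trade for determinants.\<close>
  have "w * a * trace (W ** A) = (w * a)\<^sup>2 + 2 * (x * b) * (w * a) + (w * z) * (a * c)"
    by (simp add: T power2_eq_square algebra_simps)
  also have "\<dots> = (w * a + x * b)\<^sup>2 + s\<^sup>2 + (det W * b\<^sup>2 + det A * x\<^sup>2)"
    unfolding D E s(2) by (simp add: power2_eq_square algebra_simps)
  finally have eq: "w * a * trace (W ** A) = \<dots>" .
  have "det W * b\<^sup>2 + det A * x\<^sup>2 \<ge> 2 * (s * \<bar>x * b\<bar>)"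
  proof -
    have "0 \<le> (sqrt (det W) * \<bar>b\<bar> - sqrt (det A) * \<bar>x\<bar>)\<^sup>2" by simp
    also have "\<dots> = det W * b\<^sup>2 + det A * x\<^sup>2 - 2 * (s * \<bar>x * b\<bar>)"
      using dW dA
      by (simp add: power2_diff power_mult_distrib s_def real_sqrt_mult abs_mult algebra_simps)
    finally show ?thesis by simp
  qed
  moreover have "s * \<bar>x * b\<bar> \<ge> - (s * (x * b))"
    using s(1) mult_left_mono[of "- (x * b)" "\<bar>x * b\<bar>" s] by simp
  \<comment> \<open>Expanding this square leaves a term \<open>2 * (s * (x * b))\<close> of unknown
    sign; the two preceding estimates compensate for it.\<close>
  moreover have "(w * a + x * b - s)\<^sup>2 \<ge> 0" by simp
  hence "(w * a + x * b)\<^sup>2 + s\<^sup>2 \<ge> 2 * (s * (w * a)) + 2 * (s * (x * b))"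
    by (simp add: power2_diff algebra_simps)
  ultimately have "w * a * (2 * s) \<le> w * a * trace (W ** A)"
    unfolding eq by (simp add: algebra_simps)
  then show ?thesis
    using w a by (simp add: s_def)
qed

text \<open>Meant for \<open>A = V - G\<close> and \<open>g = det G\<close>. Both sides of the bound
  are homogeneous of degree 1 in \<open>W\<close>, so the converse tests only \<open>W\<close> with
  determinant 1.\<close>

lemma trace_mult_ge_sqrt_iff:
  assumes sym: "transpose A = A" and g: "g > 0"
  shows "(\<forall>W. pos_def W \<longrightarrow> trace (W ** A) \<ge> 2 * sqrt (det W * g)) \<longleftrightarrow> pos_def A \<and> det A \<ge> g"
proof
  assume *: "pos_def A \<and> det A \<ge> g"
  show "\<forall>W. pos_def W \<longrightarrow> trace (W ** A) \<ge> 2 * sqrt (det W * g)"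
  proof (intro allI impI)
    fix W assume W: "pos_def W"
    have "2 * sqrt (det W * g) \<le> 2 * sqrt (det W * det A)"
      using W * by (simp add: pos_def2_iff)
    also have "\<dots> \<le> trace (W ** A)" using W * trace_mult_ge_sqrt_det by blast
    finally show "trace (W ** A) \<ge> 2 * sqrt (det W * g)" .
  qed
next
  assume bound: "\<forall>W. pos_def W \<longrightarrow> trace (W ** A) \<ge> 2 * sqrt (det W * g)"
  define a b c where "a = A$1$1" "b = A$1$2" "c = A$2$2"
  note defs = this
  have A21: "A$2$1 = b" using sym by (simp add: sym_mat2_iff defs)
  have unimodular: "w * a + 2 * x * b + z * c \<ge> 2 * sqrt g" if "w > 0" "w * z - x\<^sup>2 = 1" for w x z
  proof -
    define W :: "real ^ 2 ^ 2" where "W = vector [vector [w, x], vector [x, z]]"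
    have "det W = 1" using that by (simp add: W_def det_2 power2_eq_square)
    moreover from this that have "pos_def W" by (simp add: pos_def2_iff) (simp add: W_def)
    ultimately have "trace (W ** A) \<ge> 2 * sqrt g" using bound by fastforce
    then show ?thesis using A21 by (simp add: trace_mult2 W_def defs)
  qed
  have rg: "sqrt g > 0" "sqrt g * sqrt g = g" using g by simp_all
  have a: "a > 0"
  proof (rule ccontr)
    assume "\<not> a > 0"
    \<comment> \<open>If \<open>a \<le> 0\<close>, testing diag(t, 1/t) yields
      \<open>2 * sqrt g * t \<le> c\<close>; this \<open>t\<close> makes the left side
      \<open>\<bar>c\<bar> + 1\<close>.\<close>
    define t where "t = (\<bar>c\<bar> + 1) / (2 * sqrt g)"
    have t: "t > 0" using rg by (simp add: t_def add_nonneg_pos)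
    have "t * a + 1 / t * c \<ge> 2 * sqrt g"
      using unimodular[of t "1 / t" 0] t by simp
    moreover have "t * a \<le> 0" using t \<open>\<not> a > 0\<close> by (simp add: mult_le_0_iff)
    ultimately have "2 * sqrt g \<le> c / t" by simp
    with t have "2 * sqrt g * t \<le> c" by (simp add: field_simps)
    moreover have "2 * sqrt g * t = \<bar>c\<bar> + 1" using rg by (simp add: t_def)
    ultimately show False by simp
  qed
  have dA: "det A = a * c - b\<^sup>2" using A21 by (simp add: det_2 defs power2_eq_square)
  \<comment> \<open>The adjugate of [[a, b], [b, (g + b^2)/a]] has determinant \<open>g\<close>.
    Dividing it by \<open>sqrt g\<close> gives a witness of determinant 1 with lower right entry
    \<open>s\<close>; the other entries are rewritten through \<open>s\<close>.\<close>
  define s where "s = a / sqrt g"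
  have s: "s > 0" using a rg by (simp add: s_def)
  have "2 * sqrt g \<le> (s * b\<^sup>2 / a\<^sup>2 + 1 / s) * a + 2 * (- (s * b / a)) * b + s * c"
  proof (rule unimodular)
    show "s * b\<^sup>2 / a\<^sup>2 + 1 / s > 0" using s by (simp add: add_nonneg_pos)
    show "(s * b\<^sup>2 / a\<^sup>2 + 1 / s) * s - (- (s * b / a))\<^sup>2 = 1"
      using s a by (simp add: field_simps power2_eq_square)
  qed
  also have "\<dots> = a / s + s / a * det A"
    using s a by (simp add: dA field_simps power2_eq_square)
  also have "\<dots> = sqrt g + det A / sqrt g"
    using a rg by (simp add: s_def)
  finally have "sqrt g \<le> det A / sqrt g" by simp
  hence detA: "det A \<ge> g" using rg by (simp add: pos_le_divide_eq)
  with a g A21 show "pos_def A \<and> det A \<ge> g" by (simp add: pos_def2_iff defs)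
qed

lemma matrix_inv2:
  fixes V :: "real ^ 2 ^ 2"
  assumes "det V \<noteq> 0"
  shows "matrix_inv V = (1 / det V) *\<^sub>R vector [vector [V$2$2, - V$1$2], vector [- V$2$1, V$1$1]]"
    (is "_ = ?U")
proof -
  have "det V / det V = 1" using assms by simp
  hence *: "(V$1$1 * V$2$2 - V$1$2 * V$2$1) / det V = 1" by (simp only: det_2)
  have U: "V ** ?U = mat 1" "?U ** V = mat 1"
    using * by (simp_all add: vec_eq_iff forall_2 matrix_matrix_mult_def sum_2 mat_def
        diff_divide_distrib mult.commute)
  \<comment> \<open>\<open>matrix_inv\<close> is a choice among two-sided inverses, so the existence
    of \<open>?U\<close> gives it the inverse property; associativity then identifies the
    two.\<close>
  then have "V ** matrix_inv V = mat 1"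
    unfolding matrix_inv_def by (metis (mono_tags, lifting) someI_ex)
  then have "?U ** V ** matrix_inv V = ?U" by (simp add: matrix_mul_assoc[symmetric])
  with U show ?thesis by simp
qed

text \<open>The inverse is the adjugate over \<open>det V\<close>, so clearing the positive
  denominator leaves \<open>det V + det G - det (V - G) \<le> det V\<close>.\<close>

lemma trace_mult_matrix_inv_le_1_iff:
  fixes G V :: "real ^ 2 ^ 2"
  assumes "det V > 0"
  shows "trace (G ** matrix_inv V) \<le> 1 \<longleftrightarrow> det (V - G) \<ge> det G"
proof -
  have "trace (G ** matrix_inv V) = (det V + det G - det (V - G)) / det V"
    using assms by (simp add: matrix_inv2 trace_mult2 field_simps) (simp add: det_2 algebra_simps)
  then show ?thesis using assms by (simp add: pos_divide_le_eq)
qed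

theorem mainTheorem2:
  fixes \<theta>1 \<theta>2 :: real
  assumes "\<theta>1\<^sup>2 + \<theta>2\<^sup>2 < 1" and "\<theta>1 \<noteq> 0"
  shows "D_N \<theta>1 \<theta>2 = D_GM \<theta>1 \<theta>2 \<and> D_GM \<theta>1 \<theta>2 = D_det \<theta>1 \<theta>2"
proof -
  define G where "G = G_inv \<theta>1 \<theta>2"
  have "det G = 1 - \<theta>1\<^sup>2 - \<theta>2\<^sup>2"
    by (simp add: G_def G_inv_def det_2 power2_eq_square algebra_simps)
  with assms have g: "det G > 0" by simp
  \<comment> \<open>Positivity of the upper left entry of \<open>G\<close>, for Sylvester's
    criterion.\<close>
  have "\<theta>1\<^sup>2 < 1" using assms(1) zero_le_power2[of \<theta>2] by linarith
  with g have G: "pos_def G" unfolding pos_def2_iff by (simp add: G_def G_inv_def)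
  have N: "V \<in> D_N \<theta>1 \<theta>2 \<longleftrightarrow> V \<in> D_det \<theta>1 \<theta>2" for V
  proof (cases "transpose V = V")
    case True
    with G have "transpose (V - G) = V - G" by (simp add: sym_mat2_iff pos_def2_iff)
    \<comment> \<open>Moving the linear term of the Nagaoka bound to the left turns membership in
      \<open>D_N\<close> into the bound on \<open>V - G\<close>; \<open>det_mul\<close> splits the
      root.\<close>
    moreover have "trace (W ** (V - G)) = trace (W ** V) - trace (W ** G)" for W
      by (simp add: trace_mult2 algebra_simps)
    ultimately show ?thesis
      using trace_mult_ge_sqrt_iff[of "V - G" "det G"] g True
      by (auto simp: D_N_def D_det_def sym_mats_def nagaoka_bound_def G_def[symmetric]
          det_mul le_diff_eq add.commute)
  qed (simp add: D_N_def D_det_def sym_mats_def)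
  have GM: "V \<in> D_GM \<theta>1 \<theta>2 \<longleftrightarrow> V \<in> D_det \<theta>1 \<theta>2" for V
  proof (cases "pos_def (V - G)")
    case True
    \<comment> \<open>\<open>V\<close> is the sum of the positive definite matrices
      \<open>V - G\<close> and \<open>G\<close>.\<close>
    have "det V > 0" using pos_def_add[OF True G] by (simp add: pos_def2_iff)
    then show ?thesis
      by (simp add: D_GM_def D_det_def G_def[symmetric] trace_mult_matrix_inv_le_1_iff)
  qed (simp add: D_GM_def D_det_def G_def)
  from N GM show ?thesis by blast
qed

end
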